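(* Let $D_S$ be an $r$-regular digraph with self-loops of order $n$ with $\sigma$ self-loops, and let $r=\lambda_1,\lambda_2,\dots,\lambda_n$ be the eigenvalues of $A(D_S)$. Define $$S_1=\left\{i\in[n]:\Re(\lambda_i)\ge\frac{\sigma}{n}\right\},$$ $$S_2^{>0}=\left\{i\in[n]:-\frac{\sigma}{n}<\Re(\lambda_i)<\frac{\sigma}{n}\text{ and }\Re(\lambda_i)+\frac{n-\sigma}{n}>0\right\},$$ $$S_2^{\le0}=\left\{i\in[n]:-\frac{\sigma}{n}<\Re(\lambda_i)<\frac{\sigma}{n}\text{ and }\Re(\lambda_i)+\frac{n-\sigma}{n}\le0\right\},$$ $$S_3^{>0}=\left\{i\in[n]:\Re(\lambda_i)\le-\frac{\sigma}{n}\text{ and }\Re(\lambda_i)+\frac{n-\sigma}{n}>0\right\},$$ $$S_3^{\le0}=\left\{i\in[n]:\Re(\lambda_i)\le-\frac{\sigma}{n}\text{ and }\Re(\lambda_i)+\frac{n-\sigma}{n}\le0\right\},$$ and let $S_2=S_2^{>0}\cup S_2^{\le0}$, $S_3=S_3^{>0}\cup S_3^{\le0}$. If $\frac n2\le\sigma\le n$, then $$E(D_S)+E(\overline{D_S})=2(n-r-1)+2\sum_{i\in S_1\cup S_2^{\le0}\cup S_3}|\Re(\lambda_i)|+\frac{2\sigma}{n}\left(|S_2^{\le0}|+|S_3|-|S_1|+1\right)-2\left(|S_2^{\le0}|+|S_3|\right).$$ If $0\le\sigma<\frac n2$, then $$E(D_S)+E(\overline{D_S})=2(n-r-1)+2\sum_{i\in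 S_1\cup S_3^{\le0}}|\Re(\lambda_i)|+\frac{2\sigma}{n}\left(|S_3^{\le0}|-|S_1|+1\right)-2|S_3^{\le0}|.$$
   Context: A digraph with self-loops $D_S$ is a pair $(V,\mathcal A)$ with $V$ a nonempty finite vertex set and $\mathcal A\subseteq V\times V$ a set of arcs; $S=\{v\in V:(v,v)\in\mathcal A\}$ is the self-loop set (possibly empty). The order is $n=|V|$ and $\sigma=|S|$; $[n]=\{1,\dots,n\}$. The adjacency matrix $A(D_S)=(a_{ij})$ has $a_{ij}=1$ if $(v_i,v_j)\in\mathcal A$ and $0$ otherwise; eigenvalues are counted with algebraic multiplicity. $D_S$ is $r$-regular if every vertex has in-degree and out-degree equal to $r$, i.e. all row sums and column sums of $A(D_S)$ equal $r$. The energy of a digraph with self-loops of order $n$ with $\sigma$ self-loops and eigenvalues $\lambda_1,\dots,\lambda_n$ is $\sum_{i=1}^n\left|\Re(\lambda_i)-\frac{\sigma}{n}\right|$ (for $\overline{D_S}$ one uses its own eigenvalues and its own number of self-loops). Put $\delta_\sigma=1$ if $\sigma=0$ and $\delta_\sigma=0$ if $\sigma\ne0$. The complement $\overline{D_S}$ is the digraph with self-loops on $V$ with adjacency matrix $A(\overline{D_S})=J_n-\delta_\sigma I_n-A(D_S)$, where $J_n$ is the all-ones matrix and $I_n$ the identity matrix. *)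

theory Defs
  imports
    "Graph_Theory.Pair_Digraph"
    "Jordan_Normal_Form.Char_Poly"
    "HOL-Computational_Algebra.Fundamental_Theorem_Algebra"
begin

text \<open>
  A digraph with self-loops is a \<open>'a pair_pre_digraph\<close>: arcs are ordered pairs of vertices,
  parallel arcs are impossible, and loops are allowed by \<^locale>\<open>pair_fin_digraph\<close>.
\<close>

locale self_loop_digraph = pair_fin_digraph G for G :: "'a pair_pre_digraph" +
  assumes verts_nonempty: "pverts G \<noteq> {}"

definition self_loops :: "'a pair_pre_digraph \<Rightarrow> 'a set" where
  "self_loops G = {v \<in> pverts G. (v, v) \<in> parcs G}"

definition adj_entry :: "'a pair_pre_digraph \<Rightarrow> 'a \<Rightarrow> 'a \<Rightarrow> int" where
  "adj_entry G u v = (if (u, v) \<in> parcs G then 1 else 0)"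

definition enumerates :: "'a list \<Rightarrow> 'a set \<Rightarrow> bool" where
  "enumerates vs V \<longleftrightarrow> distinct vs \<and> set vs = V"

definition adjacency_matrix :: "'a list \<Rightarrow> 'a pair_pre_digraph \<Rightarrow> complex mat" where
  "adjacency_matrix vs G =
     mat (length vs) (length vs) (\<lambda>(i, j). of_int (adj_entry G (vs ! i) (vs ! j)))"

text \<open>A self-loop contributes one to the in-degree and one to the out-degree of its vertex.\<close>

definition regular_digraph :: "nat \<Rightarrow> 'a pair_pre_digraph \<Rightarrow> bool" where
  "regular_digraph r G \<longleftrightarrow>
     (\<forall>v \<in> pverts G. in_degree (with_proj G) v = r \<and> out_degree (with_proj G) v = r)"

text \<open>The multiset of eigenvalues, with algebraic multiplicities.\<close>

definition eigenvalues_mset :: "complex mat \<Rightarrow> complex multiset" where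
  "eigenvalues_mset A = proots (char_poly A)"

text \<open>
  The chosen enumeration of the vertices is immaterial, see \<open>energy_eq\<close> below.
\<close>

definition energy :: "'a pair_pre_digraph \<Rightarrow> real" where
  "energy G =
     (\<Sum>z \<in># eigenvalues_mset (adjacency_matrix (SOME vs. enumerates vs (pverts G)) G).
        \<bar>Re z - real (card (self_loops G)) / real (card (pverts G))\<bar>)"

definition loop_delta :: "nat \<Rightarrow> int" where
  "loop_delta \<sigma> = (if \<sigma> = 0 then 1 else 0)"

text \<open>
  The complement is the digraph whose adjacency matrix is \<open>J - \<delta> I - A\<close>,
  see \<open>adjacency_matrix_complement\<close> below.
\<close>

definition complement_digraph :: "'a pair_pre_digraph \<Rightarrow> 'a pair_pre_digraph" where
  "complement_digraph G =
     \<lparr> pverts = pverts G,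
       parcs = {(u, v) \<in> pverts G \<times> pverts G.
         1 - loop_delta (card (self_loops G)) * (if u = v then 1 else 0) - adj_entry G u v = 1} \<rparr>"

lemma adjacency_matrix_complement:
  assumes "self_loop_digraph G" and "enumerates vs (pverts G)"
  defines "n \<equiv> length vs"
  shows "adjacency_matrix vs (complement_digraph G) =
    mat n n (\<lambda>_. 1) - of_int (loop_delta (card (self_loops G))) \<cdot>\<^sub>m 1\<^sub>m n - adjacency_matrix vs G"
proof -
  interpret self_loop_digraph G by fact
  have vs: "distinct vs" "set vs = pverts G"
    using assms(2) by (auto simp: enumerates_def)
  have "finite (self_loops G)"
    unfolding self_loops_def using pair_finite_verts by simp
  then have "(v, v) \<notin> parcs G" if "v \<in> pverts G" "card (self_loops G) = 0" for v
    using that by (auto simp: self_loops_def)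
  then show ?thesis
    using vs nth_mem[of _ vs] unfolding n_def
    by (intro eq_matI)
      (auto simp: adjacency_matrix_def complement_digraph_def adj_entry_def loop_delta_def
        nth_eq_iff_index_eq simp del: card_eq_0_iff)
qed

lemma self_loop_digraph_complement:
  assumes "self_loop_digraph G"
  shows "self_loop_digraph (complement_digraph G)"
proof -
  interpret self_loop_digraph G by fact
  have "parcs (complement_digraph G) \<subseteq> pverts G \<times> pverts G"
    by (auto simp: complement_digraph_def)
  then have "finite (parcs (complement_digraph G))"
    using pair_finite_verts by (meson finite_SigmaI finite_subset)
  then show ?thesis
    using pair_finite_verts verts_nonempty
    by unfold_locales (auto simp: complement_digraph_def)
qed

lemma char_poly_simultaneous_permutation:
  fixes A :: "'b :: idom mat"
  assumes A: "A \<in> carrier_mat n n" and p: "p permutes {0..<n}"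
  shows "char_poly (mat n n (\<lambda>(i, j). A $$ (p i, p j))) = char_poly A"
proof -
  let ?C = "char_poly_matrix A"
  let ?R = "mat n n (\<lambda>(i, j). ?C $$ (p i, j))"
  have C: "?C \<in> carrier_mat n n" using A by simp
  have R: "?R \<in> carrier_mat n n" by simp
  have pl: "p i < n" if "i < n" for i
    using permutes_in_image[OF p, of i] that by simp
  have pinj: "p i = p j \<longleftrightarrow> i = j" for i j
    using permutes_inj[OF p] by (auto dest: injD)
  have eq: "char_poly_matrix (mat n n (\<lambda>(i, j). A $$ (p i, p j))) =
      transpose_mat (mat n n (\<lambda>(i, j). transpose_mat ?R $$ (p i, j)))"
    using A pl pinj by (intro eq_matI) (auto simp: char_poly_matrix_def)
  have "det (transpose_mat (mat n n (\<lambda>(i, j). transpose_mat ?R $$ (p i, j)))) =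
      det (mat n n (\<lambda>(i, j). transpose_mat ?R $$ (p i, j)))"
    by (rule det_transpose[where n = n]) simp
  also have "\<dots> = signof p * det (transpose_mat ?R)"
    using p by (intro det_permute_rows) auto
  also have "det (transpose_mat ?R) = det ?R"
    by (rule det_transpose[OF R])
  also have "det ?R = signof p * det ?C"
    by (rule det_permute_rows[OF C p])
  finally show ?thesis
    unfolding char_poly_def eq by (simp add: sign_def)
qed

lemma energy_eq:
  assumes "enumerates vs (pverts G)"
  shows "energy G =
    (\<Sum>z \<in># eigenvalues_mset (adjacency_matrix vs G).
       \<bar>Re z - real (card (self_loops G)) / real (card (pverts G))\<bar>)"
proof -
  define ws where "ws = (SOME vs. enumerates vs (pverts G))"
  have ws: "enumerates ws (pverts G)"
    unfolding ws_def using assms by (rule someI)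
  let ?n = "length vs"
  have "mset ws = mset vs"
    using ws assms set_eq_iff_mset_eq_distinct[of ws vs] by (simp add: enumerates_def)
  then obtain p where p: "p permutes {..<?n}" "permute_list p vs = ws"
    using mset_eq_permutation[of ws vs] by blast
  have len: "length ws = ?n" using \<open>mset ws = mset vs\<close> by (rule mset_eq_length)
  have nth: "ws ! i = vs ! p i" and pl: "p i < ?n" if "i < ?n" for i
    using permute_list_nth[OF p(1) that] p(2) permutes_in_image[OF p(1), of i] that by simp_all
  let ?A = "adjacency_matrix vs G"
  have "adjacency_matrix ws G = mat ?n ?n (\<lambda>(i, j). ?A $$ (p i, p j))"
    by (rule eq_matI) (simp_all add: adjacency_matrix_def len nth pl)
  moreover have "char_poly (mat ?n ?n (\<lambda>(i, j). ?A $$ (p i, p j))) = char_poly ?A"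
    using p(1) by (intro char_poly_simultaneous_permutation)
      (simp_all add: adjacency_matrix_def atLeast0LessThan)
  ultimately have "char_poly (adjacency_matrix ws G) = char_poly ?A"
    by (rule trans[OF arg_cong])
  then show ?thesis
    unfolding energy_def eigenvalues_mset_def ws_def[symmetric] by simp
qed

end

theory Submission
  imports Defs
begin

text \<open>
  Write \<open>J\<close> for the all-ones matrix and \<open>s = \<sigma> / n\<close>.  If all column sums of \<open>M\<close> equal \<open>k\<close>,
  then \<open>k * det (M - J) = (k - n) * det M\<close>.  Applied to \<open>M = A + (x + \<delta>) I\<close>, this says that
  passing from \<open>A\<close> to \<open>J - \<delta> I - A\<close> replaces one eigenvalue \<open>r\<close> by \<open>n - \<delta> - r\<close> and every other
  eigenvalue \<open>z\<close> by \<open>- \<delta> - z\<close>.  The loop density of the complement is \<open>1 - s - \<delta>\<close>, with or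
  without loops in the digraph, so both energies together amount to the sum of
  \<open>\<bar>x - s\<bar> + \<bar>x + 1 - s\<bar>\<close> over the real parts \<open>x\<close> of the eigenvalues, up to an
  explicit correction for the eigenvalue \<open>r\<close>.
\<close>

section \<open>Determinant and spectrum under the all-ones perturbation\<close>

text \<open>Adding all rows of \<open>M - t J\<close> to its first row makes that row constant,
  equal to \<open>k - n * t\<close>; pulling this factor out leaves a determinant independent of
  \<open>t\<close>. Comparing \<open>t = 0\<close> with \<open>t = 1\<close> gives the claim.
  Keeping \<open>k\<close> as a factor avoids dividing by it.\<close>

lemma det_minus_all_ones:
  fixes M :: "'b :: comm_ring_1 mat"
  assumes M: "M \<in> carrier_mat n n"
    and col_sum: "\<And>j. j < n \<Longrightarrow> (\<Sum>i<n. M $$ (i, j)) = k"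
  shows "k * det (M - mat n n (\<lambda>_. 1)) = (k - of_nat n) * det M"
proof (cases "n = 0")
  case True
  then show ?thesis using M by (simp add: det_def)
next
  case False
  \<comment> \<open>Left multiplication by \<open>P\<close> adds all rows to row 0, and
    \<open>M1\<close> is \<open>M\<close> with row 0 replaced by ones. \<open>Q t\<close> scales
    that row of ones by \<open>k - n * t\<close> and subtracts \<open>t\<close> times it from every
    other row.\<close>
  define P :: "'b mat" where "P = mat n n (\<lambda>(i, j). if i = 0 \<or> i = j then 1 else 0)"
  define M1 where "M1 = mat n n (\<lambda>(i, j). if i = 0 then 1 else M $$ (i, j))"
  define Q :: "'b \<Rightarrow> 'b mat" where
    "Q t = mat n n (\<lambda>(i, j). if j = 0 then (if i = 0 then k - of_nat n * t else - t)
      else if i = j then 1 else 0)" for t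
  have carrier: "P \<in> carrier_mat n n" "M1 \<in> carrier_mat n n" "Q t \<in> carrier_mat n n" for t
    by (simp_all add: P_def M1_def Q_def)
  have "upper_triangular P"
    by (auto simp: upper_triangular_def P_def)
  then have det_P: "det P = 1"
    using det_upper_triangular[OF _ carrier(1)]
    by (simp add: prod_list_diag_prod P_def)
  have det_Q: "det (Q t) = k - of_nat n * t" for t
  proof -
    have "det (Q t) = prod_list (diag_mat (Q t))"
      by (rule det_lower_triangular[OF _ carrier(3)]) (simp add: Q_def)
    also have "\<dots> = (\<Prod>i\<in>{0..<n}. if i = 0 then k - of_nat n * t else 1)"
      unfolding prod_list_diag_prod by (rule prod.cong) (auto simp: Q_def)
    also have "\<dots> = k - of_nat n * t"
      using False by simp
    finally show ?thesis .
  qed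
  have factor: "P * (M - mat n n (\<lambda>_. t)) = Q t * M1" for t
  proof (rule eq_matI)
    fix i j assume "i < dim_row (Q t * M1)" "j < dim_col (Q t * M1)"
    then have ij: "i < n" "j < n" using carrier(2) carrier(3)[of t] by auto
    have "(P * (M - mat n n (\<lambda>_. t))) $$ (i, j) =
        (\<Sum>l<n. (if i = 0 \<or> i = l then 1 else 0) * (M $$ (l, j) - t))"
      using ij M by (simp add: P_def scalar_prod_def atLeast0LessThan)
    also have "\<dots> = (if i = 0 then k - of_nat n * t else M $$ (i, j) - t)"
      using ij col_sum by (simp add: sum_subtractf if_distrib[of "\<lambda>x. x * _"] cong: if_cong)
    also have "\<dots> = (\<Sum>l<n. (if l = 0 then (if i = 0 then k - of_nat n * t else - t) else 0)
        + (if l = i \<and> i \<noteq> 0 then M $$ (i, j) else 0))"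
      using ij False by (simp add: sum.distrib)
    also have "\<dots> = (\<Sum>l<n. Q t $$ (i, l) * M1 $$ (l, j))"
      using ij by (intro sum.cong) (auto simp: Q_def M1_def)
    also have "\<dots> = (Q t * M1) $$ (i, j)"
      using ij carrier(2) carrier(3)[of t] by (simp add: scalar_prod_def atLeast0LessThan)
    finally show "(P * (M - mat n n (\<lambda>_. t))) $$ (i, j) = (Q t * M1) $$ (i, j)" .
  qed (use M carrier(1,2) carrier(3)[of t] in auto)
  have det_eq: "det (M - mat n n (\<lambda>_. t)) = (k - of_nat n * t) * det M1" for t
  proof -
    have "det (P * (M - mat n n (\<lambda>_. t))) = det (M - mat n n (\<lambda>_. t))"
      using det_mult[OF carrier(1), of "M - mat n n (\<lambda>_. t)"] det_P
      by (simp add: minus_carrier_mat)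
    then show ?thesis
      unfolding factor using det_mult[OF carrier(3) carrier(2), of t] det_Q by simp
  qed
  have "M - mat n n (\<lambda>_. 0) = M"
    using M by (intro eq_matI) auto
  then have "det M = k * det M1"
    using det_eq[of 0] by simp
  then show ?thesis
    using det_eq[of 1] by (simp add: mult_ac)
qed

text \<open>With \<open>M = A + (x + d) I\<close>, whose column sums are \<open>x + d + r\<close>,
  the two characteristic polynomials are \<open>det (M - J)\<close> at \<open>x\<close> and
  \<open>det (- M)\<close> at \<open>- x - d\<close>. The sign of the latter produces
  \<open>(- 1) ^ n\<close>.\<close>

lemma poly_char_poly_all_ones_minus:
  fixes A :: "'b :: field mat"
  assumes A: "A \<in> carrier_mat n n"
    and col_sum: "\<And>j. j < n \<Longrightarrow> (\<Sum>i<n. A $$ (i, j)) = r"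
  shows "(x + d + r) * poly (char_poly (mat n n (\<lambda>_. 1) - d \<cdot>\<^sub>m 1\<^sub>m n - A)) x =
    (x + d + r - of_nat n) * ((- 1) ^ n * poly (char_poly A) (- x - d))"
proof -
  define M where "M = A + (x + d) \<cdot>\<^sub>m 1\<^sub>m n"
  have M: "M \<in> carrier_mat n n" using A by (simp add: M_def)
  have "(\<Sum>i<n. M $$ (i, j)) = x + d + r" if "j < n" for j
    using that A col_sum
    by (simp add: M_def sum.distrib if_distrib[of "\<lambda>y. _ * y"] cong: if_cong)
  note main = det_minus_all_ones[OF M this]
  have "- char_matrix (mat n n (\<lambda>_. 1) - d \<cdot>\<^sub>m 1\<^sub>m n - A) x = M - mat n n (\<lambda>_. 1)"
    using A by (intro eq_matI) (auto simp: char_matrix_def M_def)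
  then have "poly (char_poly (mat n n (\<lambda>_. 1) - d \<cdot>\<^sub>m 1\<^sub>m n - A)) x = det (M - mat n n (\<lambda>_. 1))"
    using char_poly_matrix[of "mat n n (\<lambda>_. 1) - d \<cdot>\<^sub>m 1\<^sub>m n - A" n x] A
    by (simp add: minus_carrier_mat)
  moreover have "- char_matrix A (- x - d) = (- 1) \<cdot>\<^sub>m M"
    using A by (intro eq_matI) (auto simp: char_matrix_def M_def)
  then have "poly (char_poly A) (- x - d) = (- 1) ^ n * det M"
    using char_poly_matrix[OF A] M by simp
  ultimately show ?thesis
    using main by simp
qed

text \<open>
  The eigenvalues \<open>- (d + r)\<close> and \<open>n - d - r\<close> are added on both sides because multiset
  subtraction would hide whether \<open>r\<close> occurs among the eigenvalues of \<open>A\<close>.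
\<close>

lemma eigenvalues_mset_all_ones_minus:
  assumes A: "A \<in> carrier_mat n n"
    and col_sum: "\<And>j. j < n \<Longrightarrow> (\<Sum>i<n. A $$ (i, j)) = r"
  shows "add_mset (- (d + r)) (eigenvalues_mset (mat n n (\<lambda>_. 1) - d \<cdot>\<^sub>m 1\<^sub>m n - A)) =
    add_mset (of_nat n - d - r) (image_mset (\<lambda>z. - (d + z)) (eigenvalues_mset A))"
proof -
  define B where "B = mat n n (\<lambda>_. 1) - d \<cdot>\<^sub>m 1\<^sub>m n - A"
  define E where "E = eigenvalues_mset A"
  have B: "B \<in> carrier_mat n n" using A by (simp add: B_def minus_carrier_mat)
  have degA: "degree (char_poly A) = n" "lead_coeff (char_poly A) = 1"
    using degree_monic_char_poly[OF A] by auto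
  have size_E: "size E = n"
    using size_proots_complex degA by (simp add: E_def eigenvalues_mset_def)
  have charA: "char_poly A = (\<Prod>z\<in>#E. [:- z, 1:])"
    using complex_poly_decompose_multiset[of "char_poly A"] degA
    by (simp add: E_def eigenvalues_mset_def)
  \<comment> \<open>A linear factor at \<open>- x - d\<close> is \<open>- (x + d + z)\<close>, so
    one sign per root cancels the power of \<open>- 1\<close>.\<close>
  have sign: "(- 1) ^ size F * poly (\<Prod>z\<in>#F. [:- z, 1:]) (- x - d) =
      poly (\<Prod>z\<in>#F. [:d + z, 1:]) x" for F x
    by (induction F) (simp_all add: algebra_simps)
  have "[:d + r, 1:] * char_poly B = [:d + r - of_nat n, 1:] * (\<Prod>z\<in>#E. [:d + z, 1:])"
    (is "?L = ?R")
  proof -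
    have "poly ?L x = poly ?R x" for x
      using poly_char_poly_all_ones_minus[OF A col_sum, of x d] sign[of E x]
      by (simp add: B_def charA size_E algebra_simps)
    then show ?thesis by (simp add: poly_eq_poly_eq_iff[symmetric] fun_eq_iff)
  qed
  then have "proots ?L = proots ?R" by simp
  \<comment> \<open>\<open>proots_mult\<close> requires nonzero factors, since
    \<open>proots 0\<close> is empty.\<close>
  moreover have "char_poly B \<noteq> 0"
    using degree_monic_char_poly[OF B] by auto
  then have "proots ?L = add_mset (- (d + r)) (eigenvalues_mset B)"
    by (subst proots_mult) (simp_all add: eigenvalues_mset_def)
  moreover have "(\<Prod>z\<in>#E. [:d + z, 1:]) \<noteq> 0"
    by (auto simp: prod_mset_zero_iff)
  then have "proots ?R = add_mset (of_nat n - d - r) (proots (\<Prod>z\<in>#E. [:d + z, 1:]))"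
    by (subst proots_mult) simp_all
  moreover have "proots (\<Prod>z\<in>#F. [:d + z, 1:]) = image_mset (\<lambda>z. - (d + z)) F" for F
  proof (induction F)
    case (add z F)
    have "(\<Prod>z\<in>#F. [:d + z, 1:]) \<noteq> 0" by (auto simp: prod_mset_zero_iff)
    then have "proots ([:d + z, 1:] * (\<Prod>z\<in>#F. [:d + z, 1:])) =
        proots [:d + z, 1:] + proots (\<Prod>z\<in>#F. [:d + z, 1:])"
      by (intro proots_mult) auto
    then show ?case using add.IH by simp
  qed simp
  ultimately show ?thesis by (simp add: B_def E_def)
qed

section \<open>Counting arcs and loops\<close>

lemma adjacency_matrix_column_sum:
  assumes "self_loop_digraph G" and "regular_digraph r G"
    and enum: "enumerates vs (pverts G)" and j: "j < length vs"
  shows "(\<Sum>i<length vs. adjacency_matrix vs G $$ (i, j)) = of_nat r"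
proof -
  interpret self_loop_digraph G by fact
  have vs: "distinct vs" "set vs = pverts G"
    using enum by (auto simp: enumerates_def)
  let ?N = "{u \<in> pverts G. (u, vs ! j) \<in> parcs G}"
  have "bij_betw (\<lambda>i. vs ! i) {..<length vs} (pverts G)"
    using bij_betw_nth[OF vs(1) refl vs(2)[symmetric]] .
  then have "(\<Sum>i<length vs. adjacency_matrix vs G $$ (i, j)) =
      (\<Sum>u\<in>pverts G. of_int (adj_entry G u (vs ! j)))"
    using j by (subst sum.reindex_bij_betw[symmetric]) (simp_all add: adjacency_matrix_def)
  also have "\<dots> = (\<Sum>u\<in>pverts G. if (u, vs ! j) \<in> parcs G then 1 else 0)"
    by (intro sum.cong) (simp_all add: adj_entry_def)
  also have "\<dots> = of_nat (card ?N)"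
    using pair_finite_verts by (simp add: sum.If_cases Int_def)
  also have "card ?N = card ((\<lambda>u. (u, vs ! j)) ` ?N)"
    by (simp add: card_image inj_on_def)
  also have "(\<lambda>u. (u, vs ! j)) ` ?N = in_arcs (with_proj G) (vs ! j)"
    using in_arcsD1 by (auto simp: in_arcs_def)
  also have "card \<dots> = r"
    using assms(2) nth_mem[OF j] vs(2) by (simp add: regular_digraph_def in_degree_def)
  finally show ?thesis .
qed

text \<open>The out-neighbours of a vertex form a set of \<open>r\<close> vertices, which is a
  proper subset at a vertex without a loop. The bounds settle the sign of
  \<open>n - r - 1 + s\<close> in the energy of the complement.\<close>

lemma regular_degree_bound:
  assumes "self_loop_digraph G" and "regular_digraph r G"
  shows "r \<le> card (pverts G)"
    and "card (self_loops G) < card (pverts G) \<Longrightarrow> r < card (pverts G)"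
proof -
  interpret self_loop_digraph G by fact
  have out: "out_arcs (with_proj G) v = Pair v ` {w \<in> pverts G. (v, w) \<in> parcs G}" for v
    using in_arcsD2 by (auto simp: out_arcs_def)
  have deg: "card {w \<in> pverts G. (v, w) \<in> parcs G} = r" if "v \<in> pverts G" for v
    using that assms(2)
    by (simp add: regular_digraph_def out_degree_def out card_image inj_on_def)
  have sub: "{w \<in> pverts G. (v, w) \<in> parcs G} \<subseteq> pverts G" for v
    by auto
  obtain u where "u \<in> pverts G" using verts_nonempty by auto
  then show "r \<le> card (pverts G)"
    using deg[of u] card_mono[OF pair_finite_verts sub] by metis
  assume "card (self_loops G) < card (pverts G)"
  then obtain v where v: "v \<in> pverts G" "(v, v) \<notin> parcs G"
    unfolding self_loops_def by (metis (no_types, lifting) mem_Collect_eq order_less_irrefl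
      subsetI subset_antisym)
  then have "{w \<in> pverts G. (v, w) \<in> parcs G} \<subset> pverts G"
    by auto
  then show "r < card (pverts G)"
    using deg[OF v(1)] psubset_card_mono[OF pair_finite_verts] by metis
qed

text \<open>If there are loops, the complement toggles the loop at every vertex; if there are none,
  the term \<open>\<delta> I\<close> keeps it loopless. The factor \<open>1 - \<delta>\<close>
  covers both cases at once.\<close>

lemma card_self_loops_complement:
  assumes "self_loop_digraph G"
  shows "int (card (self_loops (complement_digraph G))) =
    (1 - loop_delta (card (self_loops G))) * int (card (pverts G)) - int (card (self_loops G))"
proof -
  interpret self_loop_digraph G by fact
  have fin: "finite (self_loops G)" and sub: "self_loops G \<subseteq> pverts G"
    using pair_finite_verts by (auto simp: self_loops_def)
  show ?thesis
  proof (cases "card (self_loops G) = 0")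
    case True
    then have "self_loops (complement_digraph G) = {}"
      by (auto simp: self_loops_def complement_digraph_def loop_delta_def adj_entry_def)
    then show ?thesis using True by (simp add: loop_delta_def)
  next
    case False
    then have "self_loops (complement_digraph G) = pverts G - self_loops G"
      by (auto simp: self_loops_def complement_digraph_def loop_delta_def adj_entry_def)
    then have "card (self_loops (complement_digraph G)) + card (self_loops G) = card (pverts G)"
      using card_Diff_subset[OF fin sub] card_mono[OF pair_finite_verts sub] by simp
    then show ?thesis using False by (simp add: loop_delta_def)
  qed
qed

section \<open>The two energies\<close>

text \<open>Since the complement has loop density \<open>1 - \<delta> - s\<close>, the shift by
  \<open>\<delta>\<close> cancels in every absolute value. The correction is the contribution
  \<open>n - r - 1 + s\<close> of the gained eigenvalue minus the contribution
  \<open>r + 1 - s\<close> of the replaced one.\<close>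

lemma energy_complement:
  assumes digraph: "self_loop_digraph G" and regular: "regular_digraph r G"
    and enum: "enumerates vs (pverts G)"
  defines "n \<equiv> card (pverts G)"
  defines "s \<equiv> real (card (self_loops G)) / real n"
  shows "energy (complement_digraph G) =
    (\<Sum>z \<in># eigenvalues_mset (adjacency_matrix vs G). \<bar>Re z + 1 - s\<bar>)
      + real n - 2 * real r - 2 + 2 * s"
proof -
  interpret self_loop_digraph G by fact
  define \<delta> where "\<delta> = real_of_int (loop_delta (card (self_loops G)))"
  define E where "E = eigenvalues_mset (adjacency_matrix vs G)"
  define F where "F = eigenvalues_mset (adjacency_matrix vs (complement_digraph G))"
  define t where "t = real (card (self_loops (complement_digraph G))) / real n"
  have len: "length vs = n"
    using enum distinct_card[of vs] by (simp add: enumerates_def n_def)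
  have n: "n > 0"
    using verts_nonempty pair_finite_verts by (auto simp: n_def card_gt_0_iff)
  have loops_le: "card (self_loops G) \<le> n"
    unfolding n_def self_loops_def using pair_finite_verts by (intro card_mono) auto
  have s: "0 \<le> s" "s \<le> 1"
    using n loops_le by (simp_all add: s_def)
  have "real (card (self_loops (complement_digraph G))) =
      (1 - \<delta>) * real n - real (card (self_loops G))"
    using arg_cong[OF card_self_loops_complement[OF digraph], of real_of_int]
    by (simp add: \<delta>_def n_def)
  then have t: "t = 1 - \<delta> - s"
    using n by (simp add: t_def s_def field_simps)
  have "add_mset (- (complex_of_real \<delta> + of_nat r)) F =
      add_mset (of_nat n - complex_of_real \<delta> - of_nat r)
        (image_mset (\<lambda>z. - (complex_of_real \<delta> + z)) E)"
    unfolding F_def E_def adjacency_matrix_complement[OF digraph enum] \<delta>_def len of_real_of_int_eq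
    by (rule eigenvalues_mset_all_ones_minus)
      (use adjacency_matrix_column_sum[OF digraph regular enum] len in
        \<open>auto simp: adjacency_matrix_def\<close>)
  from arg_cong[OF this, of "\<lambda>X. \<Sum>z\<in>#X. \<bar>Re z - t\<bar>"]
  have "\<bar>- (\<delta> + real r) - t\<bar> + (\<Sum>z\<in>#F. \<bar>Re z - t\<bar>) =
      \<bar>real n - \<delta> - real r - t\<bar> + (\<Sum>z\<in>#E. \<bar>- (\<delta> + Re z) - t\<bar>)"
    by (simp add: image_mset.compositionality comp_def)
  moreover have "\<bar>- (\<delta> + Re z) - t\<bar> = \<bar>Re z + 1 - s\<bar>" for z
    by (simp add: t)
  moreover have "\<bar>- (\<delta> + real r) - t\<bar> = real r + 1 - s"
    using s by (simp add: t)
  \<comment> \<open>A vertex without a loop forces \<open>r + 1 \<le> n\<close>; otherwise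
    \<open>s = 1\<close> and \<open>r \<le> n\<close> suffices.\<close>
  moreover have "\<bar>real n - \<delta> - real r - t\<bar> = real n - real r - 1 + s"
  proof (cases "card (self_loops G) < n")
    case True
    then have "real r + 1 \<le> real n"
      using regular_degree_bound(2)[OF digraph regular] by (simp add: n_def)
    then show ?thesis using s by (simp add: t)
  next
    case False
    then have "s = 1" using loops_le n by (simp add: s_def)
    then show ?thesis
      using regular_degree_bound(1)[OF digraph regular] by (simp add: t n_def)
  qed
  moreover have "energy (complement_digraph G) = (\<Sum>z\<in>#F. \<bar>Re z - t\<bar>)"
    using energy_eq[of vs "complement_digraph G"] enum
    by (simp add: F_def t_def n_def complement_digraph_def)
  ultimately show ?thesis by (simp add: E_def)
qed

text \<open>The summand equals 1 between \<open>s - 1\<close> and \<open>s\<close> and has slope 2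
  in absolute value outside. As \<open>0 \<le> s \<le> 1\<close>, \<open>x\<close> is nonnegative on
  \<open>P\<close> and nonpositive on \<open>N\<close>, so the excess over 1 can be written with
  \<open>\<bar>x\<bar>\<close>.\<close>

lemma sum_abs_diff_add_abs_shift:
  fixes x :: "'i \<Rightarrow> real"
  assumes "finite I" and s: "0 \<le> s" "s \<le> 1"
  defines "P \<equiv> {i \<in> I. s \<le> x i}" and "N \<equiv> {i \<in> I. x i \<le> s - 1}"
  shows "(\<Sum>i\<in>I. \<bar>x i - s\<bar> + \<bar>x i + 1 - s\<bar>) =
    card I + 2 * (\<Sum>i\<in>P \<union> N. \<bar>x i\<bar>) + 2 * s * (real (card N) - real (card P)) - 2 * card N"
proof -
  have fin: "finite P" "finite N" "P \<inter> N = {}"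
    using assms by auto
  have "\<bar>x i - s\<bar> + \<bar>x i + 1 - s\<bar> =
      1 + (if s \<le> x i then 2 * \<bar>x i\<bar> - 2 * s else 0)
        + (if x i \<le> s - 1 then 2 * \<bar>x i\<bar> + 2 * s - 2 else 0)" for i
    using s by auto
  then have "(\<Sum>i\<in>I. \<bar>x i - s\<bar> + \<bar>x i + 1 - s\<bar>) =
      card I + (\<Sum>i\<in>P. 2 * \<bar>x i\<bar> - 2 * s) + (\<Sum>i\<in>N. 2 * \<bar>x i\<bar> + 2 * s - 2)"
    using \<open>finite I\<close> by (simp add: sum.distrib P_def N_def sum.inter_filter)
  also have "\<dots> = card I + 2 * (\<Sum>i\<in>P \<union> N. \<bar>x i\<bar>)
      + 2 * s * (real (card N) - real (card P)) - 2 * card N"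
    using fin by (simp add: sum.union_disjoint sum.distrib sum_subtractf
      sum_distrib_left algebra_simps)
  finally show ?thesis .
qed

theorem theorem5p13:
  fixes D :: "'a pair_pre_digraph"
    and vs :: "'a list"
    and lam :: "nat \<Rightarrow> complex"
    and r n \<sigma> :: nat
    and S1 S2 S3 S2pos S2nonpos S3pos S3nonpos :: "nat set"
  assumes digraph: "self_loop_digraph D"
    and regular: "regular_digraph r D"
    and order: "n = card (pverts D)"
    and loops: "\<sigma> = card (self_loops D)"
    and enum: "enumerates vs (pverts D)"
    and eigenvalues:
      "image_mset lam (mset_set {1..n}) = eigenvalues_mset (adjacency_matrix vs D)"
    and lam1: "lam 1 = of_nat r"
    and S1: "S1 = {i \<in> {1..n}. Re (lam i) \<ge> real \<sigma> / real n}"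
    and S2pos: "S2pos = {i \<in> {1..n}.
      - (real \<sigma> / real n) < Re (lam i) \<and> Re (lam i) < real \<sigma> / real n \<and>
      Re (lam i) + (real n - real \<sigma>) / real n > 0}"
    and S2nonpos: "S2nonpos = {i \<in> {1..n}.
      - (real \<sigma> / real n) < Re (lam i) \<and> Re (lam i) < real \<sigma> / real n \<and>
      Re (lam i) + (real n - real \<sigma>) / real n \<le> 0}"
    and S3pos: "S3pos = {i \<in> {1..n}.
      Re (lam i) \<le> - (real \<sigma> / real n) \<and>
      Re (lam i) + (real n - real \<sigma>) / real n > 0}"
    and S3nonpos: "S3nonpos = {i \<in> {1..n}.
      Re (lam i) \<le> - (real \<sigma> / real n) \<and>
      Re (lam i) + (real n - real \<sigma>) / real n \<le> 0}"
    and S2: "S2 = S2pos \<union> S2nonpos"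
    and S3: "S3 = S3pos \<union> S3nonpos"
  shows "(real n / 2 \<le> real \<sigma> \<and> \<sigma> \<le> n \<longrightarrow>
      energy D + energy (complement_digraph D) =
        2 * (real n - real r - 1)
        + 2 * (\<Sum>i \<in> S1 \<union> S2nonpos \<union> S3. \<bar>Re (lam i)\<bar>)
        + 2 * real \<sigma> / real n
            * (real (card S2nonpos) + real (card S3) - real (card S1) + 1)
        - 2 * (real (card S2nonpos) + real (card S3)))
    \<and> (0 \<le> \<sigma> \<and> real \<sigma> < real n / 2 \<longrightarrow>
      energy D + energy (complement_digraph D) =
        2 * (real n - real r - 1)
        + 2 * (\<Sum>i \<in> S1 \<union> S3nonpos. \<bar>Re (lam i)\<bar>)
        + 2 * real \<sigma> / real n
            * (real (card S3nonpos) - real (card S1) + 1)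
        - 2 * real (card S3nonpos))"
proof -
  interpret self_loop_digraph D by fact
  define s where "s = real \<sigma> / real n"
  \<comment> \<open>\<open>N\<close> collects the indices with
    \<open>Re (lam i) + 1 - s \<le> 0\<close>. One formula in terms of \<open>S1\<close> and
    \<open>N\<close> holds for every \<open>\<sigma>\<close>; the two cases only describe
    \<open>N\<close> differently.\<close>
  define N where "N = {i \<in> {1..n}. Re (lam i) \<le> s - 1}"
  have n: "n > 0"
    using verts_nonempty pair_finite_verts by (auto simp: order card_gt_0_iff)
  have "\<sigma> \<le> n"
    unfolding order loops self_loops_def using pair_finite_verts by (intro card_mono) auto
  then have s: "0 \<le> s" "s \<le> 1"
    using n by (simp_all add: s_def)
  have sum_lam: "(\<Sum>z \<in># eigenvalues_mset (adjacency_matrix vs D). f z) = (\<Sum>i\<in>{1..n}. f (lam i))"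
    for f :: "complex \<Rightarrow> real"
    unfolding eigenvalues[symmetric]
    by (simp add: sum_unfold_sum_mset image_mset.compositionality comp_def)
  have "energy D + energy (complement_digraph D) =
      (\<Sum>i\<in>{1..n}. \<bar>Re (lam i) - s\<bar> + \<bar>Re (lam i) + 1 - s\<bar>) + real n - 2 * real r - 2 + 2 * s"
    using energy_eq[OF enum] energy_complement[OF digraph regular enum]
    by (simp add: sum_lam sum.distrib s_def order loops)
  also have "\<dots> = 2 * (real n - real r - 1) + 2 * (\<Sum>i\<in>S1 \<union> N. \<bar>Re (lam i)\<bar>)
      + 2 * s * (real (card N) - real (card S1) + 1) - 2 * real (card N)"
    using sum_abs_diff_add_abs_shift[OF finite_atLeastAtMost s, of "\<lambda>i. Re (lam i)" 1 n]
    by (simp add: S1 N_def s_def algebra_simps)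
  finally have total: "energy D + energy (complement_digraph D) = \<dots>" .
  have shift: "(real n - real \<sigma>) / real n = 1 - s"
    using n by (simp add: s_def diff_divide_distrib)
  note sets = S2nonpos S3pos S3nonpos S3 N_def shift s_def[symmetric]
  show ?thesis
  proof (intro conjI impI)
    assume "real n / 2 \<le> real \<sigma> \<and> \<sigma> \<le> n"
    then have half: "1 / 2 \<le> s"
      using n by (simp add: s_def field_simps)
    \<comment> \<open>Here \<open>- s \<le> s - 1\<close>, so \<open>S3\<close> lies in
      \<open>N\<close> entirely, and the rest of \<open>N\<close> has real part between
      \<open>- s\<close> and \<open>s\<close>.\<close>
    have N: "N = S2nonpos \<union> S3"
      using half by (auto simp: sets)
    moreover have "card (S2nonpos \<union> S3) = card S2nonpos + card S3"
      by (rule card_Un_disjoint) (auto simp: sets)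
    ultimately show "energy D + energy (complement_digraph D) =
        2 * (real n - real r - 1)
        + 2 * (\<Sum>i \<in> S1 \<union> S2nonpos \<union> S3. \<bar>Re (lam i)\<bar>)
        + 2 * real \<sigma> / real n
            * (real (card S2nonpos) + real (card S3) - real (card S1) + 1)
        - 2 * (real (card S2nonpos) + real (card S3))"
      using total by (simp add: s_def Un_assoc)
  next
    assume "0 \<le> \<sigma> \<and> real \<sigma> < real n / 2"
    then have half: "s < 1 / 2"
      using n by (simp add: s_def field_simps)
    \<comment> \<open>Now \<open>s - 1 < - s\<close>, so \<open>N\<close> lies below
      \<open>- s\<close>.\<close>
    have "N = S3nonpos"
      using half by (auto simp: sets)
    then show "energy D + energy (complement_digraph D) =
        2 * (real n - real r - 1)
        + 2 * (\<Sum>i \<in> S1 \<union> S3nonpos. \<bar>Re (lam i)\<bar>)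
        + 2 * real \<sigma> / real n
            * (real (card S3nonpos) - real (card S1) + 1)
        - 2 * real (card S3nonpos)"
      using total by (simp add: s_def)
  qed
qed

end
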